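(* For every $\theta\in(0,1]$, the satisfaction system $\Lambda_{G}=(\mathcal{L}_{G},\mathfrak{M}_{G},\models_{G})$ of propositional Gödel logic with threshold $\theta$ is both eviction-compatible and reception-compatible.
   Context: Fix a non-empty finite set $\mathcal{P}$ of atoms and a fixed atom $a\in\mathcal{P}$. $\mathcal{L}_G$ is the set of propositional formulae over $\mathcal{P}$ with connectives $\neg,\wedge,\vee,\to$. $\mathfrak{M}_G$ is the set of all functions $v:\mathcal{L}_G\to[0,1]$ satisfying Gödel semantics: $v(\neg\varphi)=1$ if $v(\varphi)=0$ and $0$ otherwise; $v(\varphi\wedge\psi)=\min(v(\varphi),v(\psi))$; $v(\varphi\vee\psi)=\max(v(\varphi),v(\psi))$; $v(\varphi\to\psi)=1$ if $v(\varphi)\le v(\psi)$ and $v(\psi)$ otherwise. For a set $B$ of formulae, $v\models_G B$ iff $v\big(\bigwedge_{\varphi\in B\cup\{\neg(\neg a\wedge a)\}}\varphi\big)\geq\theta$. For a satisfaction system $\Lambda=(\mathcal{L},\mathfrak{M},\models)$: $\mathrm{Mod}(B)=\{m\in\mathfrak{M}\mid m\models B\}$; $\mathrm{FR}(\Lambda)=\{\mathrm{Mod}(B)\mid B\subseteq\mathcal{L}$ finite$\}$; $\mathrm{FRsubs}(\mathbb{M},\Lambda)$ is the set of $\subseteq$-maximal elements of $\{X\in\mathrm{FR}(\Lambda)\mid X\subseteq\mathbb{M}\}$ and $\mathrm{FRsups}(\mathbb{M},\Lambda)$ the set of $\subseteq$-minimal elements of $\{X\in\mathrm{FR}(\Lambda)\mid\mathbb{M}\subseteq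 X\}$. $\Lambda$ is eviction-compatible if $\mathrm{FRsubs}(\mathrm{Mod}(B)\setminus\mathbb{M},\Lambda)\neq\emptyset$ for all finite $B\subseteq\mathcal{L}$ and $\mathbb{M}\subseteq\mathfrak{M}$; it is reception-compatible if $\mathrm{FRsups}(\mathrm{Mod}(B)\cup\mathbb{M},\Lambda)\neq\emptyset$ for all finite $B$ and $\mathbb{M}$. *)

theory Defs
  imports Complex_Main
begin

record ('l, 'm) satisfaction_system =
  lang :: "'l set"
  models :: "'m set"
  sat :: "'m \<Rightarrow> 'l set \<Rightarrow> bool"

definition Mod :: "('l, 'm) satisfaction_system \<Rightarrow> 'l set \<Rightarrow> 'm set" where
  "Mod \<Lambda> B = {m \<in> models \<Lambda>. sat \<Lambda> m B}"

definition FR :: "('l, 'm) satisfaction_system \<Rightarrow> 'm set set" where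
  "FR \<Lambda> = {Mod \<Lambda> B | B. B \<subseteq> lang \<Lambda> \<and> finite B}"

definition FRsubs :: "'m set \<Rightarrow> ('l, 'm) satisfaction_system \<Rightarrow> 'm set set" where
  "FRsubs M \<Lambda> = {X \<in> FR \<Lambda>. X \<subseteq> M \<and> \<not> (\<exists>Y \<in> FR \<Lambda>. Y \<subseteq> M \<and> X \<subset> Y)}"

definition FRsups :: "'m set \<Rightarrow> ('l, 'm) satisfaction_system \<Rightarrow> 'm set set" where
  "FRsups M \<Lambda> = {X \<in> FR \<Lambda>. M \<subseteq> X \<and> \<not> (\<exists>Y \<in> FR \<Lambda>. M \<subseteq> Y \<and> Y \<subset> X)}"

definition eviction_compatible :: "('l, 'm) satisfaction_system \<Rightarrow> bool" where
  "eviction_compatible \<Lambda> \<longleftrightarrow>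
    (\<forall>B M. B \<subseteq> lang \<Lambda> \<longrightarrow> finite B \<longrightarrow> M \<subseteq> models \<Lambda> \<longrightarrow> FRsubs (Mod \<Lambda> B - M) \<Lambda> \<noteq> {})"

definition reception_compatible :: "('l, 'm) satisfaction_system \<Rightarrow> bool" where
  "reception_compatible \<Lambda> \<longleftrightarrow>
    (\<forall>B M. B \<subseteq> lang \<Lambda> \<longrightarrow> finite B \<longrightarrow> M \<subseteq> models \<Lambda> \<longrightarrow> FRsups (Mod \<Lambda> B \<union> M) \<Lambda> \<noteq> {})"

datatype 'p form =
    Atom 'p
  | Neg "'p form"
  | Conj "'p form" "'p form"
  | Disj "'p form" "'p form"
  | Imp "'p form" "'p form"

definition godel_valuations :: "('p form \<Rightarrow> real) set" where
  "godel_valuations = {v.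
     (\<forall>\<phi>. 0 \<le> v \<phi> \<and> v \<phi> \<le> 1) \<and>
     (\<forall>\<phi>. v (Neg \<phi>) = (if v \<phi> = 0 then 1 else 0)) \<and>
     (\<forall>\<phi> \<psi>. v (Conj \<phi> \<psi>) = min (v \<phi>) (v \<psi>)) \<and>
     (\<forall>\<phi> \<psi>. v (Disj \<phi> \<psi>) = max (v \<phi>) (v \<psi>)) \<and>
     (\<forall>\<phi> \<psi>. v (Imp \<phi> \<psi>) = (if v \<phi> \<le> v \<psi> then 1 else v \<psi>))}"

text \<open>
  The conjunction of a finite non-empty set of formulae is formed along an arbitrary
  enumeration without repetitions; by \<open>godel_big_conj\<close> below, its value under a valuation does not
  depend on the enumeration. On empty or infinite sets it is unspecified; it is never applied to
  the empty set, and infinite sets do not matter because only finite bases enter \<open>FR\<close> and the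
  compatibility notions.
\<close>

fun list_conj :: "'p form list \<Rightarrow> 'p form" where
  "list_conj [] = undefined"
| "list_conj [\<phi>] = \<phi>"
| "list_conj (\<phi> # \<psi> # \<phi>s) = Conj \<phi> (list_conj (\<psi> # \<phi>s))"

definition big_conj :: "'p form set \<Rightarrow> 'p form" where
  "big_conj S = list_conj (SOME \<phi>s. set \<phi>s = S \<and> distinct \<phi>s)"

definition godel_sat :: "real \<Rightarrow> 'p \<Rightarrow> ('p form \<Rightarrow> real) \<Rightarrow> 'p form set \<Rightarrow> bool" where
  "godel_sat \<theta> a v B \<longleftrightarrow> v (big_conj (B \<union> {Neg (Conj (Neg (Atom a)) (Atom a))})) \<ge> \<theta>"

text \<open>
  The finite set of atoms is the type \<open>'p\<close> itself (types are non-empty), so every formula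
  belongs to the language.
\<close>

definition godel_system ::
  "real \<Rightarrow> 'p::finite \<Rightarrow> ('p form, 'p form \<Rightarrow> real) satisfaction_system" where
  "godel_system \<theta> a = \<lparr>lang = UNIV, models = godel_valuations, sat = godel_sat \<theta> a\<rparr>"

lemma godel_list_conj:
  assumes "v \<in> godel_valuations" and "\<phi>s \<noteq> []"
  shows "v (list_conj \<phi>s) = Min (v ` set \<phi>s)"
  using assms(2)
proof (induction \<phi>s rule: list_conj.induct)
  case (3 \<phi> \<psi> \<phi>s)
  have "v (list_conj (\<phi> # \<psi> # \<phi>s)) = min (v \<phi>) (v (list_conj (\<psi> # \<phi>s)))"
    using assms(1) by (simp add: godel_valuations_def)
  also have "\<dots> = min (v \<phi>) (Min (v ` set (\<psi> # \<phi>s)))"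
    using 3 by simp
  also have "\<dots> = Min (v ` set (\<phi> # \<psi> # \<phi>s))"
    by (subst Min_insert[symmetric]) auto
  finally show ?case .
qed auto

lemma godel_big_conj:
  assumes "v \<in> godel_valuations" and "finite S" and "S \<noteq> {}"
  shows "v (big_conj S) = Min (v ` S)"
proof -
  let ?\<phi>s = "SOME \<phi>s. set \<phi>s = S \<and> distinct \<phi>s"
  have *: "set ?\<phi>s = S \<and> distinct ?\<phi>s"
    by (rule someI_ex) (rule finite_distinct_list[OF assms(2)])
  then have "?\<phi>s \<noteq> []"
    using assms(3) by auto
  then show ?thesis
    using godel_list_conj[OF assms(1)] * by (simp add: big_conj_def)
qed

end

theory Submission
  imports Defs
begin

text \<open>
  Whether a formula reaches the threshold depends only on how the atoms are ordered relative to
  each other and to \<open>0\<close>, \<open>\<theta>\<close> and \<open>1\<close>, because every formula takes the value \<open>0\<close>, \<open>1\<close> or that of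
  some atom, and which of these it takes is decided by that ordering. Over finitely many atoms
  there are finitely many orderings, so \<open>FR\<close> is finite. It contains the empty set and the set of
  all valuations, hence maximal subsets and minimal supersets exist.
\<close>

text \<open>Equality tests suffice to place \<open>0\<close> and \<open>1\<close>, since Goedel
  values lie between them. For finite \<open>'p\<close> the codomain is a finite type.\<close>

definition order_type :: "real \<Rightarrow> ('p form \<Rightarrow> real) \<Rightarrow> ('p \<times> 'p) set \<times> 'p set \<times> 'p set \<times> 'p set"
  where "order_type \<theta> v =
    ({(p, q). v (Atom p) \<le> v (Atom q)}, {p. v (Atom p) = 0}, {p. v (Atom p) = 1},
     {p. \<theta> \<le> v (Atom p)})"

lemma order_type_eqD:
  assumes "order_type \<theta> v = order_type \<theta> w"
  shows "v (Atom p) \<le> v (Atom q) \<longleftrightarrow> w (Atom p) \<le> w (Atom q)"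
    and "v (Atom p) = 0 \<longleftrightarrow> w (Atom p) = 0"
    and "v (Atom p) = 1 \<longleftrightarrow> w (Atom p) = 1"
    and "\<theta> \<le> v (Atom p) \<longleftrightarrow> \<theta> \<le> w (Atom p)"
  using assms by (auto simp: order_type_def set_eq_iff)

text \<open>The induction invariant: \<open>x\<close> and \<open>y\<close> have the same origin, a
  constant or one atom. Agreement on the threshold alone would be too weak, because
  \<open>Imp\<close> compares the values of its arguments.\<close>

definition common_value :: "('p form \<Rightarrow> real) \<Rightarrow> ('p form \<Rightarrow> real) \<Rightarrow> real \<Rightarrow> real \<Rightarrow> bool" where
  "common_value v w x y \<longleftrightarrow>
    x = 0 \<and> y = 0 \<or> x = 1 \<and> y = 1 \<or> (\<exists>p. x = v (Atom p) \<and> y = w (Atom p))"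

lemma common_value_zero_iff:
  assumes "order_type \<theta> v = order_type \<theta> w" "common_value v w x y"
  shows "x = 0 \<longleftrightarrow> y = 0"
  using assms(2) order_type_eqD[OF assms(1)] by (auto simp: common_value_def)

lemma common_value_le_iff:
  assumes "v \<in> godel_valuations" "w \<in> godel_valuations" "order_type \<theta> v = order_type \<theta> w"
    and "common_value v w x y" "common_value v w x' y'"
  shows "x \<le> x' \<longleftrightarrow> y \<le> y'"
proof -
  have "0 \<le> v \<phi>" "v \<phi> \<le> 1" "0 \<le> w \<phi>" "w \<phi> \<le> 1" for \<phi>
    using assms(1,2) by (auto simp: godel_valuations_def)
  \<comment> \<open>Comparing an atom with a constant becomes an equality test, which
    \<open>order_type\<close> records.\<close>
  moreover from this have "v \<phi> \<le> 0 \<longleftrightarrow> v \<phi> = 0" "w \<phi> \<le> 0 \<longleftrightarrow> w \<phi> = 0"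
    "1 \<le> v \<phi> \<longleftrightarrow> v \<phi> = 1" "1 \<le> w \<phi> \<longleftrightarrow> w \<phi> = 1" for \<phi>
    by (auto simp: order_antisym_conv)
  ultimately show ?thesis
    using assms(4,5) order_type_eqD[OF assms(3)]
    unfolding common_value_def by (elim disjE exE conjE) simp_all
qed

text \<open>Each connective returns \<open>0\<close>, \<open>1\<close> or the value of an argument,
  and the choice depends on a zero test or a comparison, on which \<open>v\<close> and
  \<open>w\<close> agree.\<close>

lemma common_value_form:
  assumes v: "v \<in> godel_valuations" and w: "w \<in> godel_valuations"
    and eq: "order_type \<theta> v = order_type \<theta> w"
  shows "common_value v w (v \<phi>) (w \<phi>)"
proof (induction \<phi>)
  case (Atom p)
  then show ?case by (auto simp: common_value_def)
next
  case (Neg \<phi>)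
  have "v \<phi> = 0 \<longleftrightarrow> w \<phi> = 0"
    using common_value_zero_iff[OF eq Neg] .
  then show ?case
    using v w by (simp add: godel_valuations_def common_value_def)
next
  case (Conj \<phi> \<psi>)
  have "v \<phi> \<le> v \<psi> \<longleftrightarrow> w \<phi> \<le> w \<psi>"
    using common_value_le_iff[OF v w eq Conj] .
  then show ?case
    using v w Conj by (simp add: godel_valuations_def min_def)
next
  case (Disj \<phi> \<psi>)
  have "v \<phi> \<le> v \<psi> \<longleftrightarrow> w \<phi> \<le> w \<psi>"
    using common_value_le_iff[OF v w eq Disj] .
  then show ?case
    using v w Disj by (simp add: godel_valuations_def max_def)
next
  case (Imp \<phi> \<psi>)
  have "v \<phi> \<le> v \<psi> \<longleftrightarrow> w \<phi> \<le> w \<psi>"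
    using common_value_le_iff[OF v w eq Imp] .
  moreover have "common_value v w 1 1"
    by (simp add: common_value_def)
  ultimately show ?case
    using v w Imp by (simp add: godel_valuations_def)
qed

text \<open>The bounds on \<open>\<theta>\<close> settle the constants: \<open>0\<close> misses the
  threshold and \<open>1\<close> reaches it. The last component of \<open>order_type\<close> settles
  the atoms.\<close>

lemma threshold_cong:
  assumes "0 < \<theta>" "\<theta> \<le> 1" "v \<in> godel_valuations" "w \<in> godel_valuations"
    and eq: "order_type \<theta> v = order_type \<theta> w"
  shows "\<theta> \<le> v \<phi> \<longleftrightarrow> \<theta> \<le> w \<phi>"
  using common_value_form[OF assms(3-5), of \<phi>] order_type_eqD(4)[OF eq] assms(1,2)
  by (auto simp: common_value_def)

lemma Mod_godel_system:
  "Mod (godel_system \<theta> a) B = {v \<in> godel_valuations. godel_sat \<theta> a v B}"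
  by (simp add: Mod_def godel_system_def)

lemma finite_FR_godel_system:
  fixes a :: "'p::finite"
  assumes "0 < \<theta>" "\<theta> \<le> 1"
  shows "finite (FR (godel_system \<theta> a))"
proof -
  let ?F = "\<lambda>S. {v \<in> godel_valuations. order_type \<theta> v \<in> S}"
  \<comment> \<open>Satisfying \<open>B\<close> means that the single formula
    \<open>big_conj\<close> reaches the threshold, so \<open>Mod\<close> is a union of
    \<open>order_type\<close> classes.\<close>
  have "Mod (godel_system \<theta> a) B = ?F (order_type \<theta> ` Mod (godel_system \<theta> a) B)" for B
    using threshold_cong[OF assms] by (auto simp: Mod_godel_system godel_sat_def)
  then have "FR (godel_system \<theta> a) \<subseteq> range ?F"
    by (auto simp: FR_def)
  then show ?thesis
    by (rule finite_subset) simp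
qed

text \<open>The adjoined tautology has value \<open>1\<close>, so it keeps the conjunction non-empty
  without affecting whether the minimum reaches \<open>\<theta>\<close>.\<close>

lemma godel_sat_iff:
  assumes "v \<in> godel_valuations" "\<theta> \<le> 1" "finite B"
  shows "godel_sat \<theta> a v B \<longleftrightarrow> (\<forall>\<phi>\<in>B. \<theta> \<le> v \<phi>)"
proof -
  have "v (Neg (Conj (Neg (Atom a)) (Atom a))) = 1"
    using assms(1) by (simp add: godel_valuations_def)
  then show ?thesis
    using assms by (simp add: godel_sat_def godel_big_conj)
qed

lemma Mod_in_FR_godel_system: "finite B \<Longrightarrow> Mod (godel_system \<theta> a) B \<in> FR (godel_system \<theta> a)"
  by (auto simp: FR_def godel_system_def)

lemma empty_in_FR_godel_system:
  assumes "0 < \<theta>" "\<theta> \<le> 1"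
  shows "{} \<in> FR (godel_system \<theta> a)"
proof -
  \<comment> \<open>A contradiction: its value is always \<open>0\<close>, below
    \<open>\<theta>\<close>.\<close>
  let ?B = "{Conj (Neg (Atom a)) (Atom a)}"
  have "\<not> godel_sat \<theta> a v ?B" if v: "v \<in> godel_valuations" for v
  proof -
    have "v (Conj (Neg (Atom a)) (Atom a)) = 0"
      using v by (simp add: godel_valuations_def)
    then show ?thesis
      using v assms by (simp add: godel_sat_iff)
  qed
  then have "Mod (godel_system \<theta> a) ?B = {}"
    by (simp add: Mod_godel_system)
  then show ?thesis
    using Mod_in_FR_godel_system[of ?B \<theta> a] by simp
qed

lemma models_in_FR_godel_system:
  assumes "\<theta> \<le> 1"
  shows "models (godel_system \<theta> a) \<in> FR (godel_system \<theta> a)"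
proof -
  have "Mod (godel_system \<theta> a) {} = models (godel_system \<theta> a)"
    using assms unfolding Mod_godel_system by (auto simp: godel_sat_iff godel_system_def)
  then show ?thesis
    using Mod_in_FR_godel_system[of "{}" \<theta> a] by simp
qed

lemma eviction_compatible_if_finite_FR:
  assumes "finite (FR \<Lambda>)" "{} \<in> FR \<Lambda>"
  shows "eviction_compatible \<Lambda>"
proof -
  have "FRsubs M \<Lambda> \<noteq> {}" for M
  proof -
    have "finite {X \<in> FR \<Lambda>. X \<subseteq> M}" "{X \<in> FR \<Lambda>. X \<subseteq> M} \<noteq> {}"
      using assms by auto
    from finite_has_maximal[OF this] obtain X where "X \<in> FR \<Lambda>" "X \<subseteq> M"
      and "\<And>Y. Y \<in> FR \<Lambda> \<Longrightarrow> Y \<subseteq> M \<Longrightarrow> X \<subseteq> Y \<Longrightarrow> X = Y"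
      by auto
    then have "X \<in> FRsubs M \<Lambda>"
      unfolding FRsubs_def by blast
    then show ?thesis
      by blast
  qed
  then show ?thesis
    by (simp add: eviction_compatible_def)
qed

lemma reception_compatible_if_finite_FR:
  assumes "finite (FR \<Lambda>)" "models \<Lambda> \<in> FR \<Lambda>"
  shows "reception_compatible \<Lambda>"
proof -
  \<comment> \<open>The restriction on \<open>M\<close> makes \<open>models \<Lambda>\<close> a
    candidate superset.\<close>
  have "FRsups M \<Lambda> \<noteq> {}" if "M \<subseteq> models \<Lambda>" for M
  proof -
    have "finite {X \<in> FR \<Lambda>. M \<subseteq> X}" "{X \<in> FR \<Lambda>. M \<subseteq> X} \<noteq> {}"
      using assms that by auto
    from finite_has_minimal[OF this] obtain X where "X \<in> FR \<Lambda>" "M \<subseteq> X"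
      and "\<And>Y. Y \<in> FR \<Lambda> \<Longrightarrow> M \<subseteq> Y \<Longrightarrow> Y \<subseteq> X \<Longrightarrow> X = Y"
      by auto
    then have "X \<in> FRsups M \<Lambda>"
      unfolding FRsups_def by blast
    then show ?thesis
      by blast
  qed
  moreover have "Mod \<Lambda> B \<subseteq> models \<Lambda>" for B
    by (auto simp: Mod_def)
  ultimately show ?thesis
    by (simp add: reception_compatible_def)
qed

theorem theorem7:
  fixes \<theta> :: real and a :: "'p::finite"
  assumes "0 < \<theta>" and "\<theta> \<le> 1"
  shows "eviction_compatible (godel_system \<theta> a) \<and> reception_compatible (godel_system \<theta> a)"
  using assms
  by (simp add: eviction_compatible_if_finite_FR reception_compatible_if_finite_FR
      finite_FR_godel_system empty_in_FR_godel_system models_in_FR_godel_system)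

end
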